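(* Let $X$ be a real or complex Banach space, let $1<p<\infty$, and let $(x_i)\in S(\ell^p(X))$. Then the state space $S_{(x_i)}\subseteq \ell^p(X)^*$ is norm compact if and only if for each $i\in\mathbb{N}$ with $x_i\neq0$ the state space $S_{\frac{x_i}{\|x_i\|}}\subseteq X^*$ is norm compact.
   Context: For a Banach space $E$, $S(E)$ is its unit sphere. For $x\in S(E)$ the state space of $x$ is $S_x=\{x^*\in S(E^* ): x^*(x)=1\}$. $\ell^p(X)=\{(x_i)_{i\in\mathbb{N}}: x_i\in X,\ \sum_i\|x_i\|^p<\infty\}$ with norm $\|(x_i)\|=(\sum_i\|x_i\|^p)^{1/p}$; its dual is identified with $\ell^q(X^* )$, $\frac1p+\frac1q=1$, via $(x_i^* )((x_i))=\sum_i x_i^*(x_i)$. *)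

theory Defs
  imports "HOL-Analysis.Analysis" "HOL-Library.Function_Algebras"
begin

text \<open>
  A normed space over the scalar field \<open>'k\<close> is given by a scalar multiplication \<open>sc\<close>, a
  carrier \<open>V\<close> inside an additive group and a norm \<open>N\<close> on \<open>V\<close>. An explicit carrier is needed
  because the space of \<open>p\<close>-summable sequences depends on the real number \<open>p\<close> and so is not a
  type. Sequences and functionals are added pointwise, as in \<^theory>\<open>HOL-Library.Function_Algebras\<close>.
\<close>

definition unit_sphere :: "'v set \<Rightarrow> ('v \<Rightarrow> real) \<Rightarrow> 'v set"
  where "unit_sphere V N = {v \<in> V. N v = 1}"

text \<open>
  The locale \<^locale>\<open>Metric_space\<close> wants a distance that is symmetric and nonnegative on the whole
  type, hence the value \<open>0\<close> off the carrier.
\<close>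

definition norm_dist :: "'v::ab_group_add set \<Rightarrow> ('v \<Rightarrow> real) \<Rightarrow> 'v \<Rightarrow> 'v \<Rightarrow> real"
  where "norm_dist V N u v = (if u \<in> V \<and> v \<in> V then N (u - v) else 0)"

definition norm_topology :: "'v::ab_group_add set \<Rightarrow> ('v \<Rightarrow> real) \<Rightarrow> 'v topology"
  where "norm_topology V N = Metric_space.mtopology V (norm_dist V N)"

text \<open>
  A functional on \<open>V\<close> is represented by a total function that vanishes off \<open>V\<close>, so that
  functionals agreeing on \<open>V\<close> are equal.
\<close>

definition dual_space ::
    "('k::real_normed_field \<Rightarrow> 'v \<Rightarrow> 'v) \<Rightarrow> 'v::ab_group_add set \<Rightarrow> ('v \<Rightarrow> real) \<Rightarrow> ('v \<Rightarrow> 'k) set"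
  where "dual_space sc V N =
    {f. (\<forall>v. v \<notin> V \<longrightarrow> f v = 0) \<and>
        (\<forall>u\<in>V. \<forall>v\<in>V. f (u + v) = f u + f v) \<and>
        (\<forall>c. \<forall>v\<in>V. f (sc c v) = c * f v) \<and>
        (\<exists>C. \<forall>v\<in>V. norm (f v) \<le> C * N v)}"

definition dual_norm :: "'v set \<Rightarrow> ('v \<Rightarrow> real) \<Rightarrow> ('v \<Rightarrow> 'k::real_normed_field) \<Rightarrow> real"
  where "dual_norm V N f = (SUP v\<in>{v \<in> V. N v \<le> 1}. norm (f v))"

definition state_space ::
    "('k::real_normed_field \<Rightarrow> 'v \<Rightarrow> 'v) \<Rightarrow> 'v::ab_group_add set \<Rightarrow> ('v \<Rightarrow> real) \<Rightarrow> 'v \<Rightarrow> ('v \<Rightarrow> 'k) set"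
  where "state_space sc V N v =
    {f \<in> unit_sphere (dual_space sc V N) (dual_norm V N). f v = 1}"

definition norm_compact_in_dual ::
    "('k::real_normed_field \<Rightarrow> 'v \<Rightarrow> 'v) \<Rightarrow> 'v::ab_group_add set \<Rightarrow> ('v \<Rightarrow> real) \<Rightarrow> ('v \<Rightarrow> 'k) set \<Rightarrow> bool"
  where "norm_compact_in_dual sc V N S \<longleftrightarrow>
    compactin (norm_topology (dual_space sc V N) (dual_norm V N)) S"

definition lp_space :: "real \<Rightarrow> (nat \<Rightarrow> 'a::real_normed_vector) set"
  where "lp_space p = {x. summable (\<lambda>i. norm (x i) powr p)}"

definition lp_norm :: "real \<Rightarrow> (nat \<Rightarrow> 'a::real_normed_vector) \<Rightarrow> real"
  where "lp_norm p x = (\<Sum>i. norm (x i) powr p) powr (1 / p)"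

definition seq_scale :: "('k \<Rightarrow> 'a \<Rightarrow> 'a) \<Rightarrow> 'k \<Rightarrow> (nat \<Rightarrow> 'a) \<Rightarrow> (nat \<Rightarrow> 'a)"
  where "seq_scale sc c x = (\<lambda>i. sc c (x i))"

text \<open>
  The scalar multiplication of a normed space over \<open>'k\<close> whose underlying real normed space is
  the type \<open>'a\<close>. With \<open>'k = complex\<close> and \<open>'a\<close> of class \<^class>\<open>banach\<close> these are exactly the
  complex Banach spaces; with \<open>'k = real\<close> the only instance is \<^const>\<open>scaleR\<close>.
\<close>

locale normed_scaling = vector_space sc
  for sc :: "'k::real_normed_field \<Rightarrow> 'a::real_normed_vector \<Rightarrow> 'a" +
  assumes norm_sc: "norm (sc c v) = norm c * norm v"
    and sc_of_real: "sc (of_real r) v = r *\<^sub>R v"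

lemma normed_scaling_real: "normed_scaling sc \<longleftrightarrow> sc = scaleR"
proof
  assume "normed_scaling sc"
  then interpret normed_scaling sc .
  show "sc = scaleR"
    by (intro ext) (use sc_of_real in auto)
next
  assume "sc = scaleR"
  then show "normed_scaling sc"
    by unfold_locales (auto simp: algebra_simps)
qed

lemma normed_scaling_complex_mult: "normed_scaling ((*) :: complex \<Rightarrow> complex \<Rightarrow> complex)"
  by unfold_locales (auto simp: algebra_simps norm_mult scaleR_conv_of_real)

lemma Metric_space_dual:
  fixes sc :: "'k::real_normed_field \<Rightarrow> 'v::ab_group_add \<Rightarrow> 'v"
  assumes V0: "0 \<in> V" "N 0 = 0"
    and Vsc: "\<And>r v. v \<in> V \<Longrightarrow> sc (of_real r) v \<in> V"
    and Nsc: "\<And>r v. v \<in> V \<Longrightarrow> N (sc (of_real r) v) = \<bar>r\<bar> * N v"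
    and Nnn: "\<And>v. v \<in> V \<Longrightarrow> 0 \<le> N v"
  shows "Metric_space (dual_space sc V N) (norm_dist (dual_space sc V N) (dual_norm V N))"
proof -
  let ?d = "norm_dist (dual_space sc V N) (dual_norm V N)"
  let ?B = "{v \<in> V. N v \<le> 1}"
  have bdd: "bdd_above ((\<lambda>v. norm ((f - g) v)) ` ?B)"
    if fg: "f \<in> dual_space sc V N" "g \<in> dual_space sc V N" for f g
  proof -
    obtain C D where C: "\<And>v. v \<in> V \<Longrightarrow> norm (f v) \<le> C * N v"
      and D: "\<And>v. v \<in> V \<Longrightarrow> norm (g v) \<le> D * N v"
      using fg unfolding dual_space_def mem_Collect_eq by meson
    have "norm ((f - g) v) \<le> \<bar>C\<bar> + \<bar>D\<bar>" if "v \<in> ?B" for v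
    proof -
      have v: "v \<in> V" "0 \<le> N v" "N v \<le> 1" using that Nnn by auto
      have "C * N v \<le> \<bar>C\<bar> * 1" "D * N v \<le> \<bar>D\<bar> * 1"
        using v by (intro mult_mono; simp)+
      with C[OF v(1)] D[OF v(1)] norm_triangle_ineq4[of "f v" "g v"] show ?thesis
        by simp
    qed
    then show ?thesis by (intro bdd_aboveI2)
  qed
  have upper: "norm ((f - g) v) \<le> dual_norm V N (f - g)"
    if "f \<in> dual_space sc V N" "g \<in> dual_space sc V N" "v \<in> ?B" for f g v
    unfolding dual_norm_def by (rule cSUP_upper[OF that(3) bdd[OF that(1,2)]])
  have B0: "0 \<in> ?B" using V0 by auto
  show ?thesis
  proof
    fix f g :: "'v \<Rightarrow> 'k"
    have "0 \<le> dual_norm V N (f - g)" if "f \<in> dual_space sc V N" "g \<in> dual_space sc V N"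
      using upper[OF that B0] norm_ge_zero order_trans by blast
    then show "0 \<le> ?d f g" by (simp add: norm_dist_def)
    show "?d f g = ?d g f"
      unfolding norm_dist_def dual_norm_def by (simp add: norm_minus_commute)
  next
    fix f g assume fg: "f \<in> dual_space sc V N" "g \<in> dual_space sc V N"
    have "dual_norm V N (f - g) = 0 \<longleftrightarrow> f = g"
    proof
      assume d0: "dual_norm V N (f - g) = 0"
      show "f = g"
      proof
        fix v
        show "f v = g v"
        proof (cases "v \<in> V")
          case True
          define r where "r = inverse (1 + N v)"
          have r: "r > 0" using Nnn[OF True] by (simp add: r_def)
          have "\<bar>r\<bar> * N v \<le> 1"
            using Nnn[OF True] by (simp add: r_def field_simps)
          then have "sc (of_real r) v \<in> ?B" using True Vsc Nsc by auto
          from upper[OF fg this] d0 have "f (sc (of_real r) v) = g (sc (of_real r) v)"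
            by simp
          then show ?thesis using fg True r unfolding dual_space_def by auto
        qed (use fg in \<open>auto simp: dual_space_def\<close>)
      qed
    next
      assume "f = g"
      then show "dual_norm V N (f - g) = 0"
        using B0 unfolding dual_norm_def by (auto simp: image_constant_conv)
    qed
    then show "?d f g = 0 \<longleftrightarrow> f = g" using fg by (simp add: norm_dist_def)
  next
    fix f g h
    assume f: "f \<in> dual_space sc V N" and g: "g \<in> dual_space sc V N" and h: "h \<in> dual_space sc V N"
    have "dual_norm V N (f - h) \<le> dual_norm V N (f - g) + dual_norm V N (g - h)"
      unfolding dual_norm_def[of V N "f - h"]
    proof (rule cSUP_least)
      show "?B \<noteq> {}" using B0 by blast
      fix v assume v: "v \<in> ?B"
      show "norm ((f - h) v) \<le> dual_norm V N (f - g) + dual_norm V N (g - h)"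
        using upper[OF f g v] upper[OF g h v] norm_triangle_ineq[of "f v - g v" "g v - h v"]
        by simp
    qed
    then show "?d f h \<le> ?d f g + ?d g h" using f g h by (simp add: norm_dist_def)
  qed
qed

lemma Metric_space_dual_UNIV:
  assumes "normed_scaling sc"
  shows "Metric_space (dual_space sc UNIV norm) (norm_dist (dual_space sc UNIV norm) (dual_norm UNIV norm))"
proof -
  interpret normed_scaling sc by fact
  show ?thesis by (rule Metric_space_dual) (auto simp: sc_of_real)
qed

lemma Metric_space_dual_lp:
  fixes sc :: "'k::real_normed_field \<Rightarrow> 'a::real_normed_vector \<Rightarrow> 'a"
  assumes "normed_scaling sc" "1 < p"
  shows "Metric_space (dual_space (seq_scale sc) (lp_space p) (lp_norm p))
    (norm_dist (dual_space (seq_scale sc) (lp_space p) (lp_norm p)) (dual_norm (lp_space p) (lp_norm p)))"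
proof -
  interpret normed_scaling sc by fact
  show ?thesis
  proof (rule Metric_space_dual)
    fix r and x :: "nat \<Rightarrow> 'a" assume x: "x \<in> lp_space p"
    have eq: "norm (seq_scale sc (of_real r) x i) powr p = \<bar>r\<bar> powr p * norm (x i) powr p" for i
      by (simp add: seq_scale_def sc_of_real powr_mult)
    show "seq_scale sc (of_real r) x \<in> lp_space p"
      using x by (simp add: lp_space_def eq summable_mult)
    have "lp_norm p (seq_scale sc (of_real r) x) = (\<bar>r\<bar> powr p * (\<Sum>i. norm (x i) powr p)) powr (1 / p)"
      using x by (simp add: lp_norm_def lp_space_def eq suminf_mult)
    also have "\<dots> = \<bar>r\<bar> * lp_norm p x"
      using x \<open>1 < p\<close> by (simp add: lp_norm_def lp_space_def powr_mult suminf_nonneg powr_powr)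
    finally show "lp_norm p (seq_scale sc (of_real r) x) = \<bar>r\<bar> * lp_norm p x" .
  qed (auto simp: lp_space_def lp_norm_def)
qed

end

theory Submission
  imports Defs
begin

text \<open>
  Write \<open>K i\<close> for the state space of the normalized \<open>i\<close>-th coordinate of the unit sequence \<open>x\<close>, and
  \<open>K i = {0}\<close> if \<open>x i = 0\<close>. A functional is a state at \<open>x\<close> exactly if it has the form
  \<open>v \<mapsto> (\<Sum>i. norm (x i) powr (p - 1) * g i (v i))\<close> with \<open>g i \<in> K i\<close> for all \<open>i\<close>.
  This is shown without identifying the dual of the sequence space: perturbing \<open>x\<close> in one coordinate
  and comparing the state with the norm to first order gives the value of the state's \<open>i\<close>-th
  coordinate at \<open>x i\<close> and then the bound on its norm (\<open>state_coordinate_re\<close>,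
  \<open>state_coordinate_bound\<close>).

  The gluing map from the product of the \<open>K i\<close> onto the state space is continuous from the product
  topology to the dual norm, because the tails of \<open>x\<close> make all but finitely many coordinates
  uniformly negligible (\<open>glue_continuous\<close>). So compactness of all \<open>K i\<close> passes to the state space by
  Tychonoff's theorem.

  Conversely, if \<open>x i \<noteq> 0\<close>, then taking the \<open>i\<close>-th coordinate and dividing by the weight is a Lipschitz
  map from the state space into \<open>K i\<close>. It is onto because each element of \<open>K i\<close> extends to a family in
  the product; this uses that all \<open>K j\<close> are nonempty, which is the Hahn--Banach theorem in the form that
  each unit vector has a norming functional. It is proved by taking a minimal sublinear functional below
  a modification of the norm (\<open>real_norming_functional\<close>).

  The argument runs over any complete normed field with a compatible inner product, and is then
  applied to the real and the complex numbers.
\<close>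

section \<open>Norming functionals\<close>

text \<open>
  A linear functional below the norm that attains the norm at a given vector is found among the
  minimal sublinear functionals. Homogeneity is only required as an inequality, which is easier
  to verify for infima and implies equality.
\<close>
definition sublinear :: "('a::real_vector \<Rightarrow> real) \<Rightarrow> bool"
  where "sublinear P \<longleftrightarrow> (\<forall>u v. P (u + v) \<le> P u + P v) \<and> (\<forall>t\<ge>0. \<forall>v. P (t *\<^sub>R v) \<le> t * P v)"

lemma sublinear_add: "sublinear P \<Longrightarrow> P (u + v) \<le> P u + P v"
  by (simp add: sublinear_def)

lemma sublinear_zero: 
  assumes "sublinear P" shows "P 0 = 0"
proof -
  have "P 0 \<le> 0" using assms unfolding sublinear_def by (metis mult_zero_left order_refl scale_zero_left)
  moreover have "P 0 \<le> P 0 + P 0" using sublinear_add[OF assms, of 0 0] by simp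
  ultimately show ?thesis by simp
qed

lemma sublinear_scale: 
  assumes P: "sublinear P" and t: "0 \<le> t" shows "P (t *\<^sub>R v) = t * P v"
proof (cases "t = 0")
  case False
  have "P (t *\<^sub>R v) \<le> t * P v" using P t by (simp add: sublinear_def)
  moreover have "P ((1/t) *\<^sub>R (t *\<^sub>R v)) \<le> (1/t) * P (t *\<^sub>R v)"
    using P t unfolding sublinear_def by (meson divide_nonneg_nonneg zero_le_one)
  then have "t * P v \<le> P (t *\<^sub>R v)" using False t by (simp add: field_simps)
  ultimately show ?thesis by simp
qed (simp add: sublinear_zero[OF P])

lemma sublinear_ge_neg: 
  assumes "sublinear P" shows "- P (- v) \<le> P v"
  using sublinear_add[OF assms, of v "- v"] sublinear_zero[OF assms] by simp

lemma sublinear_norm: "sublinear (norm :: 'a::real_normed_vector \<Rightarrow> real)"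
  by (simp add: sublinear_def norm_triangle_ineq)

text \<open>
  The largest sublinear functional below \<open>P\<close> whose value at \<open>- w\<close> is at most \<open>- P w\<close>. It forces
  linearity along \<open>w\<close> while keeping the value at \<open>w\<close>.
\<close>
definition sublinear_reduct :: "('a::real_vector \<Rightarrow> real) \<Rightarrow> 'a \<Rightarrow> 'a \<Rightarrow> real"
  where "sublinear_reduct P w v = (INF t\<in>{0..}. P (v + t *\<^sub>R w) - t * P w)"

lemma sublinear_reduct_le:
  assumes P: "sublinear P" and t: "0 \<le> t"
  shows "sublinear_reduct P w v \<le> P (v + t *\<^sub>R w) - t * P w"
  unfolding sublinear_reduct_def
proof (rule cINF_lower)
  show "bdd_below ((\<lambda>t. P (v + t *\<^sub>R w) - t * P w) ` {0..})"
  proof (rule bdd_belowI2)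
    fix s :: real assume "s \<in> {0..}"
    then show "- P (- v) \<le> P (v + s *\<^sub>R w) - s * P w"
      using sublinear_add[OF P, of "v + s *\<^sub>R w" "- v"] sublinear_scale[OF P, of s w] by simp
  qed
qed (use t in auto)

lemma sublinear_reduct:
  assumes P: "sublinear P" shows "sublinear (sublinear_reduct P w)"
proof -
  let ?Q = "sublinear_reduct P w"
  let ?F = "\<lambda>v t. P (v + t *\<^sub>R w) - t * P w"
  have add: "?Q (u + v) \<le> ?Q u + ?Q v" for u v
  proof -
    have st: "?Q (u + v) \<le> ?F u s + ?F v t" if "0 \<le> s" "0 \<le> t" for s t
    proof -
      have "?Q (u + v) \<le> ?F (u + v) (s + t)"
        using that by (intro sublinear_reduct_le[OF P]) auto
      moreover have "P ((u + v) + (s + t) *\<^sub>R w) \<le> P (u + s *\<^sub>R w) + P (v + t *\<^sub>R w)"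
        using sublinear_add[OF P, of "u + s *\<^sub>R w" "v + t *\<^sub>R w"] by (simp add: algebra_simps)
      ultimately show ?thesis by (simp add: algebra_simps)
    qed
    have "?Q (u + v) - ?F u s \<le> ?Q v" if "0 \<le> s" for s
      unfolding sublinear_reduct_def[of P w v]
      by (rule cINF_greatest) (use st[OF that] in \<open>auto simp: algebra_simps\<close>)
    then have "?Q (u + v) - ?Q v \<le> ?Q u"
      unfolding sublinear_reduct_def[of P w u]
      by (intro cINF_greatest) (auto simp: algebra_simps)
    then show ?thesis by simp
  qed
  have scale: "?Q (r *\<^sub>R v) \<le> r * ?Q v" if r: "0 \<le> r" for r v
  proof (cases "r = 0")
    case True
    then show ?thesis
      using sublinear_reduct_le[OF P order_refl, of w 0] by (simp add: sublinear_zero[OF P])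
  next
    case False
    have "?Q (r *\<^sub>R v) \<le> r * ?F v t" if t: "0 \<le> t" for t
      using sublinear_reduct_le[OF P mult_nonneg_nonneg[OF r t], of w "r *\<^sub>R v"]
        sublinear_scale[OF P r, of "v + t *\<^sub>R w"]
      by (simp add: algebra_simps)
    then have "?Q (r *\<^sub>R v) / r \<le> ?Q v"
      unfolding sublinear_reduct_def[of P w v]
      using r False by (intro cINF_greatest) (auto simp: field_simps)
    then show ?thesis using r False by (simp add: field_simps)
  qed
  show ?thesis using add scale by (simp add: sublinear_def)
qed

text \<open>
  A minimal \<open>P\<close> equals its own reduct along every \<open>w\<close>, and the reduct with parameter \<open>t = 1\<close> gives
  \<open>P v \<le> P (v + w) - P w\<close>, the inequality that subadditivity lacks.
\<close>
lemma minimal_sublinear_linear: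
  assumes P: "sublinear P" and min: "\<And>Q. sublinear Q \<Longrightarrow> Q \<le> P \<Longrightarrow> Q = P"
  shows "P (u + v) = P u + P v" "P (t *\<^sub>R v) = t * P v"
proof -
  have eq: "sublinear_reduct P w = P" for w
  proof (rule min[OF sublinear_reduct[OF P]])
    show "sublinear_reduct P w \<le> P"
      using sublinear_reduct_le[OF P order_refl, of w] by (auto simp: le_fun_def)
  qed
  have add: "P (u + v) = P u + P v" for u v
    using sublinear_reduct_le[OF P zero_le_one, of v u] sublinear_add[OF P, of u v]
    by (simp add: eq)
  show "P (u + v) = P u + P v" by (rule add)
  have neg: "P (- w) = - P w" for w
    using add[of w "- w"] sublinear_zero[OF P] by simp
  show "P (t *\<^sub>R v) = t * P v"
  proof (cases "0 \<le> t")
    case False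
    then show ?thesis using sublinear_scale[OF P, of "- t" v] neg[of "t *\<^sub>R v"] by simp
  qed (rule sublinear_scale[OF P])
qed

text \<open>
  Zorn's lemma for the reversed pointwise order. The pointwise infimum of a chain is finite
  because \<open>P v \<ge> - P (- v) \<ge> - N (- v)\<close>, and it is subadditive because any two members of the
  chain dominate a common member.
\<close>
lemma minimal_sublinear_exists:
  assumes N: "sublinear N"
  obtains P where "sublinear P" "P \<le> N" "\<And>Q. sublinear Q \<Longrightarrow> Q \<le> P \<Longrightarrow> Q = P"
proof -
  define A where "A = {P. sublinear P \<and> P \<le> N}"
  have "\<exists>m\<in>A. \<forall>a\<in>A. a \<le> m \<longrightarrow> a = m"
  proof (rule predicate_Zorn[where P = "\<lambda>f g. g \<le> f"])
    show "partial_order_on A (relation_of (\<lambda>f g. g \<le> f) A)"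
      by (rule partial_order_on_relation_ofI) auto
    fix C assume C: "C \<in> Chains (relation_of (\<lambda>f g. g \<le> f) A)"
    show "\<exists>u\<in>A. \<forall>a\<in>C. u \<le> a"
    proof (cases "C = {}")
      case True
      then show ?thesis using N by (auto simp: A_def)
    next
      case False
      have CA: "P \<in> A" and chain: "P \<le> P' \<or> P' \<le> P" if "P \<in> C" "P' \<in> C" for P P'
        using C that unfolding Chains_def relation_of_def by blast+
      define Q where "Q v = (INF P\<in>C. P v)" for v
      have Q_le: "Q v \<le> P v" if "P \<in> C" for P v
        unfolding Q_def
      proof (rule cINF_lower[OF _ that])
        show "bdd_below ((\<lambda>P. P v) ` C)"
        proof (rule bdd_belowI2)
          fix P assume "P \<in> C"
          then have "sublinear P" "P (- v) \<le> N (- v)" using CA by (auto simp: A_def le_fun_def)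
          then show "- N (- v) \<le> P v" using sublinear_ge_neg[of P v] by linarith
        qed
      qed
      have Q_ge: "r \<le> Q v" if "\<And>P. P \<in> C \<Longrightarrow> r \<le> P v" for r v
        unfolding Q_def by (rule cINF_greatest[OF False that])
      have add: "Q (u + v) \<le> Q u + Q v" for u v
      proof -
        have le: "Q (u + v) \<le> P u + P' v" if P: "P \<in> C" "P' \<in> C" for P P'
        proof -
          obtain R where R: "R \<in> C" "R \<le> P" "R \<le> P'" using chain[OF P] P by blast
          then have "Q (u + v) \<le> R u + R v"
            using Q_le[OF R(1), of "u + v"] CA[OF R(1) R(1)] sublinear_add[of R u v]
            by (simp add: A_def)
          also have "\<dots> \<le> P u + P' v" using R by (auto simp: le_fun_def intro: add_mono)
          finally show ?thesis .
        qed
        have "Q (u + v) - P u \<le> Q v" if "P \<in> C" for P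
          by (rule Q_ge) (use le[OF that] in \<open>simp add: algebra_simps\<close>)
        then have "Q (u + v) - Q v \<le> Q u"
          by (intro Q_ge) (simp add: algebra_simps)
        then show ?thesis by simp
      qed
      have scale: "Q (t *\<^sub>R v) \<le> t * Q v" if t: "0 \<le> t" for t v
      proof -
        have le: "Q (t *\<^sub>R v) \<le> t * P v" if "P \<in> C" for P
          using Q_le[OF that, of "t *\<^sub>R v"] CA[OF that that] sublinear_scale[OF _ t, of P v]
          by (simp add: A_def)
        show ?thesis
        proof (cases "t = 0")
          case True
          then show ?thesis using le False by auto
        next
          case False
          have "Q (t *\<^sub>R v) / t \<le> Q v"
            by (rule Q_ge) (use le t False in \<open>simp add: field_simps\<close>)
          then show ?thesis using t False by (simp add: field_simps)
        qed
      qed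
      obtain P where "P \<in> C" using False by blast
      then have "Q \<le> N" using Q_le CA unfolding A_def le_fun_def mem_Collect_eq
        by (meson order_trans)
      then have "Q \<in> A" using add scale by (simp add: A_def sublinear_def)
      then show ?thesis using Q_le by (auto simp: le_fun_def)
    qed
  qed
  then obtain m where m: "m \<in> A" "\<And>a. a \<in> A \<Longrightarrow> a \<le> m \<Longrightarrow> a = m" by blast
  show thesis
  proof (rule that[of m])
    fix Q assume "sublinear Q" "Q \<le> m"
    then show "Q = m" using m by (auto simp: A_def)
  qed (use m in \<open>auto simp: A_def\<close>)
qed

text \<open>
  Minimizing below the reduct of the norm along \<open>w\<close>, instead of below the norm itself, gives
  \<open>P (- w) \<le> - norm w\<close>, so that the linear \<open>P\<close> attains the norm at \<open>w\<close>.
\<close>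
lemma real_norming_functional:
  fixes w :: "'a::real_normed_vector"
  obtains f :: "'a \<Rightarrow> real" where
    "\<And>u v. f (u + v) = f u + f v" "\<And>t v. f (t *\<^sub>R v) = t * f v"
    "\<And>v. f v \<le> norm v" "f w = norm w"
proof -
  let ?N = "sublinear_reduct norm w"
  obtain P where P: "sublinear P" "P \<le> ?N" "\<And>Q. sublinear Q \<Longrightarrow> Q \<le> P \<Longrightarrow> Q = P"
    using minimal_sublinear_exists[OF sublinear_reduct[OF sublinear_norm]] by blast
  note lin = minimal_sublinear_linear[OF P(1,3)]
  have le: "P v \<le> norm v" for v
    using P(2) sublinear_reduct_le[OF sublinear_norm order_refl, of w v]
    by (auto simp: le_fun_def intro: order_trans)
  have "P (- w) \<le> - norm w"
    using P(2) sublinear_reduct_le[OF sublinear_norm zero_le_one, of w "- w"]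
    by (auto simp: le_fun_def intro: order_trans)
  then have "P w = norm w" using lin(2)[of "- 1" w] le[of w] by simp
  then show thesis using that[of P] lin le by blast
qed

section \<open>Duals and state spaces\<close>

lemma scalar_rotation:
  fixes a :: "'k::real_normed_field"
  obtains c where "norm c = 1" "c * a = of_real (norm a)"
proof (cases "a = 0")
  case True
  then show ?thesis using that[of 1] by simp
next
  case False
  then show ?thesis using that[of "of_real (norm a) / a"] by (simp add: norm_divide)
qed

text \<open>
  The real and the complex field are treated together as normed fields with an inner product, in
  which \<open>a \<bullet> 1\<close> is the real part of \<open>a\<close>.
\<close>
lemma inner_one_le_norm:
  fixes a :: "'k::{real_normed_field, real_inner}"
  shows "a \<bullet> 1 \<le> norm a"
  using norm_cauchy_schwarz[of a 1] by simp

lemma of_real_inner_one: "(of_real r :: 'k::{real_normed_field, real_inner}) \<bullet> 1 = r"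
  by (simp add: of_real_def dot_square_norm)

text \<open>
  Equality case of the Cauchy--Schwarz inequality: a scalar whose real part is at least its norm
  lies on the positive half-line.
\<close>
lemma eq_of_real_if_norm_le_inner_one:
  fixes a :: "'k::{real_normed_field, real_inner}"
  assumes "norm a \<le> r" "r \<le> a \<bullet> 1"
  shows "a = of_real r"
proof -
  have r: "norm a = r" "a \<bullet> 1 = r" using assms inner_one_le_norm[of a] by auto
  have "a \<bullet> a = r\<^sup>2" "(of_real r :: 'k) \<bullet> of_real r = r\<^sup>2" "a \<bullet> of_real r = r\<^sup>2"
    using r by (simp_all add: dot_square_norm) (simp add: of_real_def power2_eq_square)
  then have "(a - of_real r) \<bullet> (a - of_real r) = 0"
    by (simp add: inner_diff inner_commute[of "of_real r" a])
  then show ?thesis by simp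
qed

text \<open>
  What the scalar field, acting through its real elements, must respect so that bounded functionals can be
  compared on the unit ball. The whole space \<open>'a\<close> and the sequence space are both instances.
\<close>
locale normed_carrier =
  fixes sc :: "'k::real_normed_field \<Rightarrow> 'v::ab_group_add \<Rightarrow> 'v" and V :: "'v set" and N :: "'v \<Rightarrow> real"
  assumes zero_mem: "0 \<in> V" and N_zero: "N 0 = 0"
    and scale_mem: "v \<in> V \<Longrightarrow> sc (of_real r) v \<in> V"
    and N_scale: "v \<in> V \<Longrightarrow> N (sc (of_real r) v) = \<bar>r\<bar> * N v"
    and N_nonneg: "v \<in> V \<Longrightarrow> 0 \<le> N v"
begin

abbreviation "dual \<equiv> dual_space sc V N"

sublocale dual: Metric_space dual "norm_dist dual (dual_norm V N)"
  by (rule Metric_space_dual[OF zero_mem N_zero scale_mem N_scale N_nonneg])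

lemma norm_topology_dual: "norm_topology dual (dual_norm V N) = dual.mtopology"
  by (simp add: norm_topology_def)

lemma dual_norm_le:
  assumes "\<And>v. v \<in> V \<Longrightarrow> N v \<le> 1 \<Longrightarrow> norm (f v) \<le> C"
  shows "dual_norm V N f \<le> C"
  unfolding dual_norm_def by (rule cSUP_least) (use assms zero_mem N_zero in auto)

lemma norm_le_dual_norm:
  fixes f :: "'v \<Rightarrow> 'k"
  assumes f: "f \<in> dual" and v: "v \<in> V"
  shows "norm (f v) \<le> dual_norm V N f * N v"
proof -
  obtain C where C: "\<And>v. v \<in> V \<Longrightarrow> norm (f v) \<le> C * N v"
    using f unfolding dual_space_def by blast
  have bdd: "bdd_above ((\<lambda>v. norm (f v)) ` {v \<in> V. N v \<le> 1})"
  proof (rule bdd_aboveI2)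
    fix v assume v: "v \<in> {v \<in> V. N v \<le> 1}"
    have "norm (f v) \<le> C * N v" using C v by auto
    also have "\<dots> \<le> \<bar>C\<bar> * 1" using v N_nonneg by (intro mult_mono) auto
    finally show "norm (f v) \<le> \<bar>C\<bar> * 1" .
  qed
  show ?thesis
  proof (cases "N v = 0")
    case True
    then show ?thesis using C[OF v] by simp
  next
    case False
    let ?r = "1 / N v"
    have pos: "0 < N v" using False N_nonneg[OF v] by simp
    have "norm (f (sc (of_real ?r) v)) \<le> dual_norm V N f"
      unfolding dual_norm_def
      by (rule cSUP_upper[OF _ bdd]) (use v pos scale_mem N_scale in \<open>auto simp del: of_real_divide\<close>)
    moreover have "f (sc (of_real ?r) v) = of_real ?r * f v"
      using f v unfolding dual_space_def by blast
    ultimately show ?thesis using pos by (simp add: norm_mult norm_divide field_simps del: of_real_divide)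
  qed
qed

lemma diff_mem_dual:
  assumes f: "f \<in> dual" and g: "g \<in> dual"
  shows "f - g \<in> dual"
proof -
  have "norm ((f - g) v) \<le> (dual_norm V N f + dual_norm V N g) * N v" if "v \<in> V" for v
    using norm_le_dual_norm[OF f that] norm_le_dual_norm[OF g that] norm_triangle_ineq4[of "f v" "g v"]
    by (simp add: algebra_simps)
  then have "\<exists>C. \<forall>v\<in>V. norm ((f - g) v) \<le> C * N v" by blast
  then show ?thesis using f g unfolding dual_space_def by (simp add: algebra_simps)
qed

lemma norm_diff_le_dist:
  assumes f: "f \<in> dual" and g: "g \<in> dual" and v: "v \<in> V"
  shows "norm (f v - g v) \<le> norm_dist dual (dual_norm V N) f g * N v"
  using norm_le_dual_norm[OF diff_mem_dual[OF f g] v] f g by (simp add: norm_dist_def)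

lemma dist_le:
  assumes f: "f \<in> dual" and g: "g \<in> dual"
    and le: "\<And>v. v \<in> V \<Longrightarrow> N v \<le> 1 \<Longrightarrow> norm (f v - g v) \<le> C"
  shows "norm_dist dual (dual_norm V N) f g \<le> C"
  using f g le by (auto simp: norm_dist_def intro!: dual_norm_le)

text \<open>
  At a unit vector the value \<open>1\<close> already bounds the dual norm from below, so a state is a functional
  of value \<open>1\<close> that the norm dominates.
\<close>
lemma state_space_iff:
  assumes v: "v \<in> V" and N1: "N v = 1"
  shows "f \<in> state_space sc V N v \<longleftrightarrow> f \<in> dual \<and> f v = 1 \<and> (\<forall>u\<in>V. norm (f u) \<le> N u)"
proof
  assume "f \<in> state_space sc V N v"
  then have "f \<in> dual" "dual_norm V N f = 1" "f v = 1"
    by (auto simp: state_space_def unit_sphere_def)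
  then show "f \<in> dual \<and> f v = 1 \<and> (\<forall>u\<in>V. norm (f u) \<le> N u)"
    using norm_le_dual_norm[of f] by simp
next
  assume f: "f \<in> dual \<and> f v = 1 \<and> (\<forall>u\<in>V. norm (f u) \<le> N u)"
  then have "dual_norm V N f \<le> 1" by (intro dual_norm_le) auto
  moreover have "1 \<le> dual_norm V N f" using norm_le_dual_norm[of f v] f v N1 by simp
  ultimately show "f \<in> state_space sc V N v" using f by (simp add: state_space_def unit_sphere_def)
qed

end

lemma (in normed_scaling) normed_carrier_UNIV: "normed_carrier sc UNIV norm"
  by unfold_locales (auto simp: sc_of_real)

lemma state_space_real_nonempty:
  fixes w :: "'a::real_normed_vector"
  assumes "norm w = 1"
  shows "state_space scaleR UNIV norm w \<noteq> {}"
proof -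
  interpret normed_scaling "scaleR :: real \<Rightarrow> 'a \<Rightarrow> 'a" by (simp add: normed_scaling_real)
  interpret X: normed_carrier "scaleR :: real \<Rightarrow> 'a \<Rightarrow> 'a" UNIV norm by (rule normed_carrier_UNIV)
  obtain f :: "'a \<Rightarrow> real" where f: "\<And>u v. f (u + v) = f u + f v" "\<And>t v. f (t *\<^sub>R v) = t * f v"
    "\<And>v. f v \<le> norm v" "f w = norm w"
    using real_norming_functional[of w] by blast
  have le: "\<bar>f v\<bar> \<le> norm v" for v using f(3)[of v] f(3)[of "- v"] f(2)[of "- 1" v] by auto
  have "f \<in> state_space scaleR UNIV norm w"
    using f le assms by (auto simp: X.state_space_iff dual_space_def intro: exI[of _ 1])
  then show ?thesis by blast
qed

text \<open>
  A complex functional is recovered from its real part \<open>f\<close> as \<open>f v - \<i> f (\<i> v)\<close>. Rotating \<open>F v\<close> onto the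
  positive half-line shows that its norm bound is the one of \<open>f\<close>.
\<close>
lemma state_space_complex_nonempty:
  fixes sc :: "complex \<Rightarrow> 'a::real_normed_vector \<Rightarrow> 'a"
  assumes "normed_scaling sc" and w: "norm w = 1"
  shows "state_space sc UNIV norm w \<noteq> {}"
proof -
  interpret normed_scaling sc by fact
  interpret X: normed_carrier sc UNIV norm by (rule normed_carrier_UNIV)
  obtain f :: "'a \<Rightarrow> real" where f: "\<And>u v. f (u + v) = f u + f v" "\<And>t v. f (t *\<^sub>R v) = t * f v"
    "\<And>v. f v \<le> norm v" "f w = norm w"
    using real_norming_functional[of w] by blast
  define F where "F v = Complex (f v) (- f (sc \<i> v))" for v
  have sc_split: "sc c v = Re c *\<^sub>R v + Im c *\<^sub>R sc \<i> v" for c v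
  proof -
    have "sc c v = sc (of_real (Re c) + of_real (Im c) * \<i>) v"
      by (simp add: complex_eq mult.commute)
    also have "\<dots> = sc (of_real (Re c)) v + sc (of_real (Im c)) (sc \<i> v)"
      by (simp only: scale_left_distrib scale_scale)
    finally show ?thesis by (simp only: sc_of_real)
  qed
  have ii: "f (sc \<i> (sc \<i> v)) = - f v" for v
  proof -
    have "sc \<i> (sc \<i> v) = (- 1) *\<^sub>R v" by simp
    then show ?thesis using f(2)[of "- 1" v] by simp
  qed
  have add: "F (u + v) = F u + F v" for u v
    by (simp add: F_def f(1) scale_right_distrib complex_eq_iff)
  have scl: "F (sc c v) = c * F v" for c v
  proof -
    have 1: "f (sc c v) = Re c * f v + Im c * f (sc \<i> v)" by (subst sc_split) (simp only: f)
    have "sc \<i> (sc c v) = sc c (sc \<i> v)" by (simp add: mult.commute)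
    then have 2: "f (sc \<i> (sc c v)) = Re c * f (sc \<i> v) - Im c * f v"
      using sc_split[of c "sc \<i> v"] by (simp only: f ii mult_minus_right diff_conv_add_uminus)
    show ?thesis by (simp only: F_def 1 2) (simp add: complex_eq_iff)
  qed
  have le: "norm (F v) \<le> norm v" for v
  proof -
    obtain c where c: "norm c = 1" "c * F v = of_real (norm (F v))" by (rule scalar_rotation)
    have "norm (F v) = Re (F (sc c v))" using c scl by simp
    also have "\<dots> \<le> norm (sc c v)" using f(3) by (simp add: F_def)
    finally show ?thesis using c by (simp add: norm_sc)
  qed
  have "Re (F w) = 1" using f(4) w by (simp add: F_def)
  then have "F w = 1"
    using eq_of_real_if_norm_le_inner_one[of "F w" 1] le[of w] w by (simp add: inner_complex_def)
  then have "F \<in> state_space sc UNIV norm w"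
    using add scl le w by (auto simp: X.state_space_iff dual_space_def intro: exI[of _ 1])
  then show ?thesis by blast
qed

section \<open>Hoelder's inequality for series\<close>

text \<open>
  Young's inequality for the exponents \<open>p\<close> and \<open>p / (p - 1)\<close>, the latter applied to \<open>a powr (p - 1)\<close>.
  In this form the conjugate exponent does not appear.
\<close>
lemma Holder_pointwise:
  fixes a b :: real
  assumes p: "1 < p" and "0 \<le> a" "0 \<le> b"
  shows "a powr (p - 1) * b \<le> (1 - 1/p) * a powr p + (1/p) * b powr p"
proof -
  have "b * a powr (p - 1) \<le> b powr p / p + (a powr (p - 1)) powr (p/(p-1)) / (p/(p-1))"
    by (rule Youngs_inequality) (use assms in \<open>auto simp: field_simps\<close>)
  moreover have "(a powr (p - 1)) powr (p/(p-1)) = a powr p" using p by (simp add: powr_powr)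
  moreover have "a powr p / (p/(p-1)) = (1 - 1/p) * a powr p" using p by (simp add: field_simps)
  ultimately show ?thesis by (simp add: mult.commute)
qed

lemma Holder_summable:
  fixes a b :: "nat \<Rightarrow> real"
  assumes p: "1 < p" and nn: "\<And>i. 0 \<le> a i" "\<And>i. 0 \<le> b i"
    and sm: "summable (\<lambda>i. a i powr p)" "summable (\<lambda>i. b i powr p)"
  shows "summable (\<lambda>i. a i powr (p - 1) * b i)"
proof (rule summable_comparison_test')
  show "summable (\<lambda>i. (1 - 1/p) * a i powr p + (1/p) * b i powr p)"
    by (intro summable_add summable_mult sm)
  show "norm (a i powr (p - 1) * b i) \<le> (1 - 1/p) * a i powr p + (1/p) * b i powr p" if "i \<ge> 0" for i
    using Holder_pointwise[OF p nn(1)[of i] nn(2)[of i]] nn(2)[of i] by (simp add: abs_mult)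
qed

text \<open>
  The pointwise inequality is summed after dividing by \<open>A\<close> and \<open>B\<close>; the weights \<open>ca\<close> and \<open>cb\<close>
  are its coefficients after this rescaling. Upper bounds \<open>A\<close> and \<open>B\<close> instead of the norms
  themselves avoid division by zero.
\<close>
lemma Holder_series:
  fixes a b :: "nat \<Rightarrow> real"
  assumes p: "1 < p" and nn: "\<And>i. 0 \<le> a i" "\<And>i. 0 \<le> b i"
    and sm: "summable (\<lambda>i. a i powr p)" "summable (\<lambda>i. b i powr p)"
    and A: "(\<Sum>i. a i powr p) \<le> A powr p" "0 < A"
    and B: "(\<Sum>i. b i powr p) \<le> B powr p" "0 < B"
  shows "(\<Sum>i. a i powr (p - 1) * b i) \<le> A powr (p - 1) * B"
proof -
  note s = Holder_summable[OF p nn sm]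
  define ca where "ca = (1 - 1/p) / A powr p"
  define cb where "cb = (1/p) / B powr p"
  have "(\<Sum>i. (a i powr (p - 1) * b i) / (A powr (p - 1) * B)) \<le> (\<Sum>i. ca * a i powr p + cb * b i powr p)"
  proof (rule suminf_le)
    fix i
    have "(a i / A) powr (p - 1) * (b i / B) \<le> (1 - 1/p) * (a i / A) powr p + (1/p) * (b i / B) powr p"
      by (rule Holder_pointwise) (use p nn A B in auto)
    then show "(a i powr (p - 1) * b i) / (A powr (p - 1) * B) \<le> ca * a i powr p + cb * b i powr p"
      using nn A B by (simp add: powr_divide ca_def cb_def)
  qed (intro summable_add summable_mult summable_divide sm s)+
  also have "\<dots> = ca * (\<Sum>i. a i powr p) + cb * (\<Sum>i. b i powr p)"
    by (simp add: suminf_add[symmetric] suminf_mult summable_mult sm)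
  also have "\<dots> \<le> ca * A powr p + cb * B powr p"
    using p A B by (intro add_mono mult_left_mono) (auto simp: ca_def cb_def)
  also have "\<dots> = 1" using A B by (simp add: ca_def cb_def)
  finally have "(\<Sum>i. (a i powr (p - 1) * b i) / (A powr (p - 1) * B)) \<le> 1" .
  then show "(\<Sum>i. a i powr (p - 1) * b i) \<le> A powr (p - 1) * B"
    using A B s by (simp add: suminf_divide field_simps)
qed

section \<open>Sequences with summable powers and their functionals\<close>

lemma lp_norm_powr:
  assumes "x \<in> lp_space p" "1 < p"
  shows "lp_norm p x powr p = (\<Sum>i. norm (x i) powr p)"
  using assms by (simp add: lp_norm_def lp_space_def powr_powr suminf_nonneg)

lemma norm_coord_le_lp_norm:
  assumes x: "x \<in> lp_space p" and p: "1 < p"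
  shows "norm (x i) \<le> lp_norm p x"
proof -
  have "norm (x i) powr p = (\<Sum>j\<in>{i}. norm (x j) powr p)" by simp
  also have "\<dots> \<le> (\<Sum>j. norm (x j) powr p)"
    using x by (intro sum_le_suminf) (auto simp: lp_space_def)
  finally have "(norm (x i) powr p) powr (1/p) \<le> lp_norm p x"
    unfolding lp_norm_def using p by (intro powr_mono2) auto
  then show ?thesis using p by (simp add: powr_powr)
qed

lemma lp_space_add:
  assumes x: "x \<in> lp_space p" and y: "y \<in> lp_space p" and p: "1 < p"
  shows "x + y \<in> lp_space p"
proof -
  have "summable (\<lambda>i. norm (x i + y i) powr p)"
  proof (rule summable_comparison_test')
    show "summable (\<lambda>i. 2 powr p * (norm (x i) powr p + norm (y i) powr p))"
      using x y by (intro summable_mult summable_add) (auto simp: lp_space_def)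
    fix i
    have "norm (x i + y i) powr p \<le> (2 * max (norm (x i)) (norm (y i))) powr p"
      using p norm_triangle_ineq[of "x i" "y i"] by (intro powr_mono2) auto
    also have "\<dots> = 2 powr p * max (norm (x i)) (norm (y i)) powr p"
      by (simp add: powr_mult)
    also have "\<dots> \<le> 2 powr p * (norm (x i) powr p + norm (y i) powr p)"
      by (intro mult_left_mono) (auto simp: max_def)
    finally show "norm (norm (x i + y i) powr p) \<le> 2 powr p * (norm (x i) powr p + norm (y i) powr p)"
      by simp
  qed
  then show ?thesis by (simp add: lp_space_def)
qed

text \<open>
  Replacing one coordinate changes the sum of powers by one term. Sequences with
  one nonzero term are the case \<open>x = 0\<close>.
\<close>
lemma lp_space_fun_upd:
  fixes x :: "nat \<Rightarrow> 'a::real_normed_vector"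
  assumes x: "x \<in> lp_space p"
  shows "x(i := y) \<in> lp_space p"
    and "(\<Sum>j. norm ((x(i := y)) j) powr p) = (\<Sum>j. norm (x j) powr p) - norm (x i) powr p + norm y powr p"
proof -
  have "(\<lambda>j. norm (x j) powr p + (if j = i then norm y powr p - norm (x j) powr p else 0)) sums
      ((\<Sum>j. norm (x j) powr p) + (norm y powr p - norm (x i) powr p))"
    using x by (intro sums_add sums_single[of i "\<lambda>j. norm y powr p - norm (x j) powr p"])
      (auto simp: lp_space_def summable_sums)
  moreover have "(\<lambda>j. norm (x j) powr p + (if j = i then norm y powr p - norm (x j) powr p else 0)) =
      (\<lambda>j. norm ((x(i := y)) j) powr p)" by auto
  ultimately have "(\<lambda>j. norm ((x(i := y)) j) powr p) sums
      ((\<Sum>j. norm (x j) powr p) - norm (x i) powr p + norm y powr p)"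
    by (simp add: algebra_simps)
  then show "x(i := y) \<in> lp_space p"
    "(\<Sum>j. norm ((x(i := y)) j) powr p) = (\<Sum>j. norm (x j) powr p) - norm (x i) powr p + norm y powr p"
    by (auto simp: lp_space_def sums_iff)
qed

lemma lp_space_single: "(0 :: nat \<Rightarrow> 'a::real_normed_vector)(i := u) \<in> lp_space p"
  by (rule lp_space_fun_upd) (simp add: lp_space_def)

lemma lp_norm_single:
  assumes "1 < p"
  shows "lp_norm p ((0 :: nat \<Rightarrow> 'a::real_normed_vector)(i := u)) = norm u"
proof -
  have "(0 :: nat \<Rightarrow> 'a) \<in> lp_space p" by (simp add: lp_space_def)
  then show ?thesis
    using assms by (simp add: lp_norm_def lp_space_fun_upd powr_powr del: fun_upd_apply)
qed

text \<open>The tail keeps its indices, so that it is the difference of \<open>v\<close> and a finite sequence.\<close>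
definition lp_tail :: "nat \<Rightarrow> (nat \<Rightarrow> 'a::zero) \<Rightarrow> nat \<Rightarrow> 'a"
  where "lp_tail n v = (\<lambda>i. if i < n then 0 else v i)"

lemma lp_tail:
  fixes v :: "nat \<Rightarrow> 'a::real_normed_vector"
  assumes v: "v \<in> lp_space p" and p: "1 < p"
  shows "lp_tail n v \<in> lp_space p" and "(\<lambda>n. lp_norm p (lp_tail n v)) \<longlonglongrightarrow> 0"
proof -
  have sv: "summable (\<lambda>i. norm (v i) powr p)" using v by (simp add: lp_space_def)
  have mem: "lp_tail n v \<in> lp_space p" for n
    unfolding lp_space_def mem_Collect_eq
    by (rule summable_comparison_test'[OF sv]) (auto simp: lp_tail_def)
  then show "lp_tail n v \<in> lp_space p" .
  have "(\<Sum>i. norm (lp_tail n v i) powr p) = (\<Sum>i. norm (v (i + n)) powr p)" for n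
    using suminf_split_initial_segment[of "\<lambda>i. norm (lp_tail n v i) powr p" n] mem[of n]
    by (simp add: lp_space_def) (simp add: lp_tail_def)
  then have "lp_norm p (lp_tail n v) = (\<Sum>i. norm (v (i + n)) powr p) powr (1 / p)" for n
    by (simp add: lp_norm_def)
  moreover have "(\<lambda>n. (\<Sum>i. norm (v (i + n)) powr p) powr (1 / p)) \<longlonglongrightarrow> 0 powr (1 / p)"
    using p suminf_exist_split2[OF sv] sv
    by (intro tendsto_powr') (auto intro!: always_eventually suminf_nonneg summable_ignore_initial_segment)
  ultimately show "(\<lambda>n. lp_norm p (lp_tail n v)) \<longlonglongrightarrow> 0" using p by simp
qed

locale lp_dual = normed_scaling sc
  for sc :: "'k::{real_normed_field, banach, real_inner} \<Rightarrow> 'a::real_normed_vector \<Rightarrow> 'a" +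
  fixes p :: real
  assumes p: "1 < p"
begin

lemma seq_scale_lp:
  assumes "v \<in> lp_space p"
  shows "seq_scale sc c v \<in> lp_space p" "lp_norm p (seq_scale sc c v) = norm c * lp_norm p v"
proof -
  have eq: "norm (seq_scale sc c v i) powr p = norm c powr p * norm (v i) powr p" for i
    by (simp add: seq_scale_def norm_sc powr_mult)
  show "seq_scale sc c v \<in> lp_space p"
    using assms by (simp add: lp_space_def eq summable_mult)
  show "lp_norm p (seq_scale sc c v) = norm c * lp_norm p v"
    using assms p by (simp add: lp_space_def lp_norm_def eq suminf_mult powr_mult suminf_nonneg powr_powr)
qed

lemma powr_pred: "0 \<le> r \<Longrightarrow> r powr (p - 1) * r = r powr p"
  using p by (cases "r = 0") (auto simp: powr_diff)

sublocale X: normed_carrier sc UNIV norm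
  by (rule normed_carrier_UNIV)

sublocale E: normed_carrier "seq_scale sc" "lp_space p" "lp_norm p"
  by unfold_locales (auto simp: seq_scale_lp, auto simp: lp_space_def lp_norm_def)

definition coordinate_functional :: "((nat \<Rightarrow> 'a) \<Rightarrow> 'k) \<Rightarrow> nat \<Rightarrow> 'a \<Rightarrow> 'k"
  where "coordinate_functional f i u = f (0(i := u))"

lemma coordinate_functional_linear:
  assumes f: "f \<in> E.dual"
  shows "coordinate_functional f i (u + v) = coordinate_functional f i u + coordinate_functional f i v"
    and "coordinate_functional f i (sc c u) = c * coordinate_functional f i u"
    and "coordinate_functional f i (r *\<^sub>R u) = of_real r * coordinate_functional f i u"
    and "coordinate_functional f i (u - v) = coordinate_functional f i u - coordinate_functional f i v"
proof -
  let ?F = "coordinate_functional f i"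
  have add: "?F (u + v) = ?F u + ?F v" for u v
  proof -
    have "(0(i := u + v)) = 0(i := u) + (0 :: nat \<Rightarrow> 'a)(i := v)" by (auto simp: fun_eq_iff)
    then show ?thesis using f unfolding dual_space_def coordinate_functional_def
      by (simp add: lp_space_single)
  qed
  have scl: "?F (sc c u) = c * ?F u" for c u
  proof -
    have "(0(i := sc c u)) = seq_scale sc c (0(i := u))" by (auto simp: fun_eq_iff seq_scale_def)
    then show ?thesis using f unfolding dual_space_def coordinate_functional_def
      by (simp add: lp_space_single)
  qed
  show "?F (u + v) = ?F u + ?F v" by (rule add)
  show "?F (sc c u) = c * ?F u" by (rule scl)
  show "?F (r *\<^sub>R u) = of_real r * ?F u" using scl[of "of_real r" u] by (simp add: sc_of_real)
  show "?F (u - v) = ?F u - ?F v" using add[of "u - v" v] by simp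
qed

text \<open>
  Finitely supported sequences are dense: the functional at \<open>v\<close> differs from the partial sum by its
  value at a tail of \<open>v\<close>, whose norm tends to \<open>0\<close>.
\<close>
lemma dual_lp_sums:
  assumes f: "f \<in> E.dual" and v: "v \<in> lp_space p"
  shows "(\<lambda>i. coordinate_functional f i (v i)) sums f v"
proof -
  have split: "f v = (\<Sum>i<n. coordinate_functional f i (v i)) + f (lp_tail n v)" for n
  proof (induction n)
    case 0
    then show ?case by (simp add: lp_tail_def)
  next
    case (Suc n)
    have "lp_tail n v = 0(n := v n) + lp_tail (Suc n) v" by (auto simp: lp_tail_def fun_eq_iff less_Suc_eq)
    then have "f (lp_tail n v) = f (0(n := v n)) + f (lp_tail (Suc n) v)"
      using f lp_tail(1)[OF v p] unfolding dual_space_def by (simp add: lp_space_single)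
    then show ?case using Suc by (simp add: coordinate_functional_def)
  qed
  have "(\<lambda>n. f (lp_tail n v)) \<longlonglongrightarrow> 0"
  proof (rule Lim_null_comparison)
    show "\<forall>\<^sub>F n in sequentially. norm (f (lp_tail n v))
        \<le> dual_norm (lp_space p) (lp_norm p) f * lp_norm p (lp_tail n v)"
      using E.norm_le_dual_norm[OF f] lp_tail(1)[OF v p] by (auto intro: always_eventually)
    show "(\<lambda>n. dual_norm (lp_space p) (lp_norm p) f * lp_norm p (lp_tail n v)) \<longlonglongrightarrow> 0"
      using tendsto_mult_right_zero[OF lp_tail(2)[OF v p]] .
  qed
  then have "(\<lambda>n. f v - f (lp_tail n v)) \<longlonglongrightarrow> f v - 0" by (intro tendsto_diff tendsto_const)
  moreover have "f v - f (lp_tail n v) = (\<Sum>i<n. coordinate_functional f i (v i))" for n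
    using split[of n] by simp
  ultimately show ?thesis by (simp add: sums_def)
qed

end

section \<open>States at a unit sequence\<close>

text \<open>
  Concavity of \<open>y powr (1/p)\<close> at \<open>1\<close>. It turns the norm of a perturbed unit sequence into an
  expression in which only the perturbed coordinate occurs.
\<close>
lemma powr_inverse_le_tangent:
  fixes y p :: real
  assumes p: "1 < p" and y: "0 \<le> y"
  shows "y powr (1/p) \<le> 1 + (y - 1) / p"
proof -
  have "y powr (1/p) * 1 \<le> (y powr (1/p)) powr p / p + 1 powr (p/(p-1)) / (p/(p-1))"
    by (rule Youngs_inequality) (use p in \<open>auto simp: field_simps\<close>)
  then show ?thesis using p y by (simp add: powr_powr field_simps)
qed

locale lp_sphere_point = lp_dual sc p
  for sc :: "'k::{real_normed_field, banach, real_inner} \<Rightarrow> 'a::real_normed_vector \<Rightarrow> 'a" and p +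
  fixes x :: "nat \<Rightarrow> 'a"
  assumes x_mem: "x \<in> lp_space p" and x_norm: "lp_norm p x = 1"
begin

abbreviation "state \<equiv> state_space (seq_scale sc) (lp_space p) (lp_norm p) x"

lemma sum_x: "(\<Sum>i. norm (x i) powr p) = 1"
  using lp_norm_powr[OF x_mem p] x_norm by simp

lemma summable_x: "summable (\<lambda>i. norm (x i) powr p)"
  using x_mem by (simp add: lp_space_def)

lemma norm_x_le: "norm (x i) \<le> 1"
  using norm_coord_le_lp_norm[OF x_mem p] x_norm by simp

lemma powr_x_le: "norm (x i) powr p \<le> 1"
  using norm_x_le[of i] p by (intro powr_le1) auto

lemmas state_iff = E.state_space_iff[OF x_mem x_norm]

text \<open>
  A state is bounded by the norm at the sequence obtained from \<open>x\<close> by putting \<open>y\<close> at position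
  \<open>i\<close>. This single inequality, for varying \<open>y\<close>, determines the coordinates of the state.
\<close>
lemma state_perturb:
  assumes f: "f \<in> state"
  shows "norm (1 + coordinate_functional f i (y - x i)) \<le> (1 - norm (x i) powr p + norm y powr p) powr (1/p)"
proof -
  have f': "f \<in> E.dual" "f x = 1" "\<And>u. u \<in> lp_space p \<Longrightarrow> norm (f u) \<le> lp_norm p u"
    using f state_iff by auto
  have "x(i := y) = x + 0(i := y - x i)" by (auto simp: fun_eq_iff)
  then have "f (x(i := y)) = 1 + coordinate_functional f i (y - x i)"
    using f' x_mem unfolding dual_space_def coordinate_functional_def by (simp add: lp_space_single)
  moreover have "lp_norm p (x(i := y)) = (1 - norm (x i) powr p + norm y powr p) powr (1/p)"
    unfolding lp_norm_def lp_space_fun_upd(2)[OF x_mem] sum_x ..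
  ultimately show ?thesis using f'(3)[OF lp_space_fun_upd(1)[OF x_mem], of i y] by simp
qed

lemma state_perturb_re:
  assumes f: "f \<in> state"
  shows "coordinate_functional f i (y - x i) \<bullet> 1 \<le> (norm y powr p - norm (x i) powr p) / p"
proof -
  have "1 + coordinate_functional f i (y - x i) \<bullet> 1 = (1 + coordinate_functional f i (y - x i)) \<bullet> 1"
    by (simp add: inner_add_left dot_square_norm)
  also have "\<dots> \<le> norm (1 + coordinate_functional f i (y - x i))" by (rule inner_one_le_norm)
  also have "\<dots> \<le> (1 - norm (x i) powr p + norm y powr p) powr (1/p)" by (rule state_perturb[OF f])
  also have "\<dots> \<le> 1 + ((1 - norm (x i) powr p + norm y powr p) - 1) / p"
    using powr_x_le[of i] by (intro powr_inverse_le_tangent p) auto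
  finally show ?thesis by (simp add: field_simps)
qed

text \<open>
  For \<open>y = (1 + s) x i\<close> the perturbation inequality is an equality at \<open>s = 0\<close>, so both sides have the
  same derivative there.
\<close>
lemma state_coordinate_re:
  assumes f: "f \<in> state"
  shows "coordinate_functional f i (x i) \<bullet> 1 = norm (x i) powr p"
proof -
  let ?r = "coordinate_functional f i (x i) \<bullet> 1"
  let ?A = "norm (x i) powr p"
  have fd: "f \<in> E.dual" using f state_iff by auto
  define D where "D s = ((1 + s) powr p - 1) * ?A / p - s * ?r" for s
  have "0 \<le> D s" if s: "\<bar>s\<bar> < 1" for s
  proof -
    let ?y = "(1 + s) *\<^sub>R x i"
    have "coordinate_functional f i (?y - x i) = of_real s * coordinate_functional f i (x i)"
      using coordinate_functional_linear(3)[OF fd, of i s "x i"] by (simp add: algebra_simps)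
    then have "coordinate_functional f i (?y - x i) \<bullet> 1 = s * ?r"
      by (simp add: scaleR_conv_of_real[symmetric])
    moreover have "norm ?y powr p = (1 + s) powr p * ?A" using s by (simp add: powr_mult)
    ultimately show ?thesis using state_perturb_re[OF f, of i ?y] by (simp add: D_def algebra_simps)
  qed
  moreover have "D 0 = 0" by (simp add: D_def)
  moreover have "DERIV D 0 :> ?A - ?r"
    unfolding D_def using p by (auto intro!: derivative_eq_intros)
  ultimately have "?A - ?r = 0" by (intro DERIV_local_min[of D _ 0 1]) auto
  then show ?thesis by simp
qed

text \<open>
  Rotating \<open>u\<close> makes the coordinate functional real and nonnegative at it. If \<open>x i \<noteq> 0\<close>, rescaling the rotated
  vector to the norm of \<open>x i\<close> leaves the norm of the perturbed sequence unchanged. If \<open>x i = 0\<close>, the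
  perturbation by a vector of size \<open>t\<close> enlarges the norm only by the order of \<open>t powr p\<close>, which for
  small \<open>t\<close> is less than any positive multiple of \<open>t\<close>; here \<open>p > 1\<close> is essential.
\<close>
lemma state_coordinate_bound:
  assumes f: "f \<in> state"
  shows "norm (coordinate_functional f i u) \<le> norm (x i) powr (p - 1) * norm u"
proof -
  let ?F = "coordinate_functional f i"
  have fd: "f \<in> E.dual" using f state_iff by auto
  note lin = coordinate_functional_linear[OF fd, of i]
  obtain c where c: "norm c = 1" "c * ?F u = of_real (norm (?F u))" by (rule scalar_rotation)
  define w where "w = sc c u"
  have w: "?F w = of_real (norm (?F u))" "norm w = norm u"
    using c by (simp_all add: w_def lin norm_sc)
  have re: "?F (t *\<^sub>R w) \<bullet> 1 = t * norm (?F u)" for t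
    using of_real_inner_one[of "t * norm (?F u)", where 'k = 'k] by (simp add: lin w)
  show ?thesis
  proof (cases "x i = 0")
    case True
    let ?r = "norm (?F u)" and ?C = "norm u powr p / p"
    have C: "0 \<le> ?C" using p by simp
    have "?r = 0"
    proof (rule ccontr)
      assume "?r \<noteq> 0"
      then have r: "0 < ?r" by simp
      \<comment> \<open>This \<open>t\<close> solves \<open>t powr (p - 1) * (?C + 1) = ?r\<close>, so \<open>t powr (p - 1) * ?C\<close> falls short of \<open>?r\<close>.\<close>
      define t where "t = (?r / (?C + 1)) powr (1 / (p - 1))"
      have t: "0 < t" "t powr (p - 1) = ?r / (?C + 1)"
        using r C p by (auto simp: t_def powr_powr add_nonneg_pos less_imp_neq[symmetric])
      have "t * ?r \<le> norm (t *\<^sub>R w) powr p / p"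
        using state_perturb_re[OF f, of i "t *\<^sub>R w"] p True by (simp add: re)
      also have "\<dots> = t * (t powr (p - 1) * ?C)"
      proof -
        have "t powr p = t * t powr (p - 1)" using t powr_pred[of t] by (simp add: mult.commute)
        moreover have "norm (t *\<^sub>R w) powr p / p = t powr p * ?C" using t(1) by (simp add: powr_mult w)
        ultimately show ?thesis by (simp only: mult.assoc)
      qed
      finally have "?r \<le> t powr (p - 1) * ?C" using t(1) by (simp only: mult_le_cancel_left_pos)
      moreover have "t powr (p - 1) * (?C + 1) = ?r" using t(2) C by simp
      moreover have "0 < t powr (p - 1)" using t(1) by simp
      ultimately show False by (simp only: distrib_left mult_1_right)
    qed
    then show ?thesis by simp
  next
    case False
    show ?thesis
    proof (cases "u = 0")
      case True
      then show ?thesis using lin(3)[of 0 u] by simp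
    next
      case nz: False
      define t where "t = norm (x i) / norm u"
      have t: "0 < t" using False nz by (simp add: t_def)
      have ny: "norm (t *\<^sub>R w) = norm (x i)" using nz by (simp add: w t_def)
      have "?F (t *\<^sub>R w - x i) \<bullet> 1 \<le> 0" using state_perturb_re[OF f, of i "t *\<^sub>R w"] ny by simp
      then have "t * norm (?F u) \<le> norm (x i) powr p"
        using state_coordinate_re[OF f, of i] re[of t] by (simp add: lin(4) inner_diff_left)
      then have "norm (x i) * norm (?F u) \<le> norm (x i) * (norm (x i) powr (p - 1) * norm u)"
        using nz powr_pred[of "norm (x i)"] by (simp add: t_def field_simps)
      then show ?thesis using False by simp
    qed
  qed
qed

lemma state_coordinate_self:
  assumes f: "f \<in> state"
  shows "coordinate_functional f i (x i) = of_real (norm (x i) powr p)"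
  by (rule eq_of_real_if_norm_le_inner_one)
    (use state_coordinate_bound[OF f, of i "x i"] state_coordinate_re[OF f, of i] powr_pred[of "norm (x i)"]
     in auto)

text \<open>
  The possible normalized coordinates of a state. At positions where \<open>x\<close> vanishes a state has
  zero coordinate, which is expressed by the compact set \<open>{0}\<close>.
\<close>
definition coordinate_states :: "nat \<Rightarrow> ('a \<Rightarrow> 'k) set"
  where "coordinate_states i =
    (if x i = 0 then {0} else state_space sc UNIV norm (x i /\<^sub>R norm (x i)))"

lemma coordinate_states_iff:
  "g \<in> coordinate_states i \<longleftrightarrow> g \<in> X.dual \<and> (\<forall>u. norm (g u) \<le> norm u) \<and> g (x i) = of_real (norm (x i)) \<and> (x i = 0 \<longrightarrow> g = 0)"
proof (cases "x i = 0")
  case True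
  then show ?thesis by (auto simp: coordinate_states_def dual_space_def intro: exI[of _ 0])
next
  case False
  have eq: "g (x i /\<^sub>R norm (x i)) = of_real (1 / norm (x i)) * g (x i)" if "g \<in> X.dual"
  proof -
    have "g (sc (of_real (1 / norm (x i))) (x i)) = of_real (1 / norm (x i)) * g (x i)"
      using that unfolding dual_space_def by blast
    then show ?thesis by (simp only: sc_of_real) (simp add: divide_inverse)
  qed
  then have "g (x i /\<^sub>R norm (x i)) = 1 \<longleftrightarrow> g (x i) = of_real (norm (x i))" if "g \<in> X.dual"
    unfolding eq[OF that] using False by (simp add: field_simps)
  then show ?thesis using False by (auto simp: coordinate_states_def X.state_space_iff)
qed

text \<open>
  The weight \<open>norm (x i) powr (p - 1)\<close> is the norm that the \<open>i\<close>-th coordinate of a state has under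
  the identification of the dual with the sequence space of the conjugate exponent.
\<close>
definition glue :: "(nat \<Rightarrow> 'a \<Rightarrow> 'k) \<Rightarrow> (nat \<Rightarrow> 'a) \<Rightarrow> 'k"
  where "glue g v = (if v \<in> lp_space p then \<Sum>i. of_real (norm (x i) powr (p - 1)) * g i (v i) else 0)"

lemma glue_summable:
  fixes g :: "nat \<Rightarrow> 'a \<Rightarrow> 'k"
  assumes g: "\<And>i u. norm (g i u) \<le> norm u" and v: "v \<in> lp_space p"
  shows "summable (\<lambda>i. norm (of_real (norm (x i) powr (p - 1)) * g i (v i)))"
proof (rule summable_comparison_test')
  show "summable (\<lambda>i. norm (x i) powr (p - 1) * norm (v i))"
    by (rule Holder_summable[OF p]) (use v x_mem in \<open>auto simp: lp_space_def\<close>)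
  show "norm (norm (of_real (norm (x i) powr (p - 1)) * g i (v i))) \<le> norm (x i) powr (p - 1) * norm (v i)"
    if "i \<ge> 0" for i
    using mult_left_mono[OF g[of i "v i"], of "norm (x i) powr (p - 1)"] by (simp add: norm_mult)
qed

lemma glue_bound:
  assumes g: "\<And>i u. norm (g i u) \<le> norm u" and v: "v \<in> lp_space p"
  shows "norm (glue g v) \<le> lp_norm p v"
proof (cases "lp_norm p v = 0")
  case True
  have "g i (v i) = 0" for i
    using norm_coord_le_lp_norm[OF v p, of i] g[of i "v i"] True by simp
  then show ?thesis using True by (simp add: glue_def)
next
  case False
  then have pos: "0 < lp_norm p v" using E.N_nonneg[OF v] by simp
  have sm: "summable (\<lambda>i. norm (x i) powr (p - 1) * norm (v i))"
    by (rule Holder_summable[OF p]) (use v x_mem in \<open>auto simp: lp_space_def\<close>)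
  have "norm (glue g v) \<le> (\<Sum>i. norm (of_real (norm (x i) powr (p - 1)) * g i (v i)))"
    using v summable_norm[OF glue_summable[OF g v]] by (simp add: glue_def)
  also have "\<dots> \<le> (\<Sum>i. norm (x i) powr (p - 1) * norm (v i))"
    by (intro suminf_le glue_summable g v sm) (simp add: norm_mult mult_left_mono g)
  also have "\<dots> \<le> 1 powr (p - 1) * lp_norm p v"
    using v x_mem by (intro Holder_series[OF p]) (auto simp: sum_x lp_norm_powr[OF v p] pos lp_space_def)
  finally show ?thesis by simp
qed

lemma glue_mem_state:
  assumes g: "\<And>i. g i \<in> coordinate_states i"
  shows "glue g \<in> state"
proof -
  have gi: "g i \<in> X.dual" "norm (g i u) \<le> norm u" "g i (x i) = of_real (norm (x i))" for i u
    using g[of i] by (auto simp: coordinate_states_iff)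
  have lin: "g i (u + v) = g i u + g i v" "g i (sc c u) = c * g i u" for i u v c
    using gi(1)[of i] unfolding dual_space_def by auto
  have sm: "summable (\<lambda>i. of_real (norm (x i) powr (p - 1)) * g i (v i))" if "v \<in> lp_space p" for v
    by (rule summable_norm_cancel[OF glue_summable[OF gi(2) that]])
  have "glue g (u + v) = glue g u + glue g v" if "u \<in> lp_space p" "v \<in> lp_space p" for u v
    using that sm by (simp add: glue_def lp_space_add[OF _ _ p] lin distrib_left suminf_add)
  moreover have "glue g (seq_scale sc c v) = c * glue g v" if "v \<in> lp_space p" for c v
    using that suminf_mult[OF sm[OF that], of c]
    by (simp add: glue_def seq_scale_lp) (simp add: seq_scale_def lin mult_ac)
  moreover have "norm (glue g v) \<le> 1 * lp_norm p v" if "v \<in> lp_space p" for v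
    using glue_bound[OF gi(2) that] by simp
  moreover have "glue g v = 0" if "v \<notin> lp_space p" for v using that by (simp add: glue_def)
  ultimately have "glue g \<in> E.dual" unfolding dual_space_def mem_Collect_eq by blast
  moreover have "glue g x = of_real (\<Sum>i. norm (x i) powr p)"
    using x_mem suminf_of_real[OF summable_x, where 'a = 'k, symmetric]
    by (simp add: glue_def gi powr_pred flip: of_real_mult)
  ultimately show ?thesis using glue_bound[OF gi(2)] by (simp add: state_iff sum_x)
qed

text \<open>At positions where \<open>x\<close> vanishes the division by \<open>0\<close> gives the functional \<open>0\<close>, as wanted.\<close>
definition coordinate_state :: "nat \<Rightarrow> ((nat \<Rightarrow> 'a) \<Rightarrow> 'k) \<Rightarrow> 'a \<Rightarrow> 'k"
  where "coordinate_state i f u = coordinate_functional f i u / of_real (norm (x i) powr (p - 1))"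

lemma coordinate_state_mem_dual:
  assumes f: "f \<in> E.dual"
  shows "coordinate_state i f \<in> X.dual"
proof -
  let ?a = "norm (x i) powr (p - 1)"
  have "norm (coordinate_state i f u) \<le> (dual_norm (lp_space p) (lp_norm p) f / ?a) * norm u" for u
    using E.norm_le_dual_norm[OF f lp_space_single, of i u]
    by (simp add: coordinate_state_def coordinate_functional_def norm_divide lp_norm_single[OF p] divide_right_mono)
  then have "\<exists>C. \<forall>u. norm (coordinate_state i f u) \<le> C * norm u" by blast
  then show ?thesis
    unfolding dual_space_def
    by (simp add: coordinate_state_def coordinate_functional_linear[OF f] add_divide_distrib)
qed

lemma coordinate_state_mem:
  assumes f: "f \<in> state"
  shows "coordinate_state i f \<in> coordinate_states i"
proof -
  let ?a = "norm (x i) powr (p - 1)"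
  have fd: "f \<in> E.dual" using f state_iff by auto
  have "norm (coordinate_state i f u) \<le> norm u" for u
    using state_coordinate_bound[OF f, of i u]
    by (cases "x i = 0") (auto simp: coordinate_state_def norm_divide field_simps)
  moreover have "coordinate_state i f (x i) = of_real (norm (x i))"
    using powr_pred[of "norm (x i)"]
    by (cases "x i = 0") (auto simp: coordinate_state_def state_coordinate_self[OF f] field_simps simp flip: of_real_mult)
  moreover have "coordinate_state i f = 0" if "x i = 0"
    using that by (auto simp: coordinate_state_def fun_eq_iff)
  ultimately show ?thesis using coordinate_state_mem_dual[OF fd] by (simp add: coordinate_states_iff)
qed

text \<open>
  Together with the next lemma this says that a state is the same as a family of normalized
  coordinates. The bound on coordinates is needed where the weight is \<open>0\<close>: it makes the
  coordinate functional vanish, so that nothing is lost by the division.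
\<close>
lemma glue_coordinate_state:
  assumes f: "f \<in> state"
  shows "glue (\<lambda>i. coordinate_state i f) = f"
proof
  fix v
  have fd: "f \<in> E.dual" using f state_iff by auto
  have "of_real (norm (x i) powr (p - 1)) * coordinate_state i f u = coordinate_functional f i u" for i u
    using state_coordinate_bound[OF f, of i u]
    by (cases "x i = 0") (auto simp: coordinate_state_def)
  then show "glue (\<lambda>i. coordinate_state i f) v = f v"
    using dual_lp_sums[OF fd, of v] fd by (auto simp: glue_def sums_iff dual_space_def)
qed

lemma coordinate_state_glue:
  assumes "x i \<noteq> 0" and g: "\<And>j. g j \<in> coordinate_states j"
  shows "coordinate_state i (glue g) = g i"
proof
  fix u
  let ?a = "\<lambda>j. of_real (norm (x j) powr (p - 1)) :: 'k"
  have "g j 0 = 0" for j using g[of j] by (auto simp: coordinate_states_iff dest: spec[of _ 0])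
  then have "(\<lambda>j. ?a j * g j ((0(i := u)) j)) = (\<lambda>j. if j = i then ?a j * g j u else 0)"
    by auto
  then have "(\<lambda>j. ?a j * g j ((0(i := u)) j)) sums (?a i * g i u)"
    using sums_single[of i "\<lambda>j. ?a j * g j u"] by simp
  then have "glue g (0(i := u)) = ?a i * g i u"
    by (simp add: glue_def lp_space_single sums_iff)
  then show "coordinate_state i (glue g) u = g i u"
    using assms(1) by (simp add: coordinate_state_def coordinate_functional_def)
qed

lemma state_eq_glue_image: "state = glue ` (\<Pi>\<^sub>E i\<in>UNIV. coordinate_states i)"
proof
  show "state \<subseteq> glue ` (\<Pi>\<^sub>E i\<in>UNIV. coordinate_states i)"
  proof
    fix f assume f: "f \<in> state"
    show "f \<in> glue ` (\<Pi>\<^sub>E i\<in>UNIV. coordinate_states i)"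
      by (rule image_eqI[where x = "\<lambda>i. coordinate_state i f"])
        (auto simp: glue_coordinate_state[OF f] intro: coordinate_state_mem[OF f])
  qed
  show "glue ` (\<Pi>\<^sub>E i\<in>UNIV. coordinate_states i) \<subseteq> state"
    by (auto intro: glue_mem_state)
qed

section \<open>Compactness\<close>

text \<open>
  The first \<open>n\<close> coordinates are controlled by their distances. For the others only the trivial
  bound \<open>2\<close> is used; they contribute little by Hoelder's inequality because the tail of \<open>x\<close> is
  small, uniformly in the two families.
\<close>
lemma glue_dist_le:
  assumes g: "\<And>i. g i \<in> coordinate_states i" and h: "\<And>i. h i \<in> coordinate_states i"
    and close: "\<And>i. i < n \<Longrightarrow> norm_dist X.dual (dual_norm UNIV norm) (g i) (h i) \<le> \<delta>"
    and A: "0 < A" "(\<Sum>i. norm (x (i + n)) powr p) \<le> A powr p"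
  shows "norm_dist E.dual (dual_norm (lp_space p) (lp_norm p)) (glue g) (glue h)
      \<le> n * \<delta> + 2 * A powr (p - 1)"
proof (rule E.dist_le)
  show "glue g \<in> E.dual" "glue h \<in> E.dual"
    using glue_mem_state[OF g] glue_mem_state[OF h] state_iff by auto
  fix v :: "nat \<Rightarrow> 'a" assume v: "v \<in> lp_space p" and N: "lp_norm p v \<le> 1"
  let ?a = "\<lambda>i. norm (x i) powr (p - 1)"
  let ?d = "\<lambda>i. norm (of_real (?a i) * g i (v i) - of_real (?a i) * h i (v i))"
  have gh: "g i \<in> X.dual" "h i \<in> X.dual" "norm (g i u) \<le> norm u" "norm (h i u) \<le> norm u" for i u
    using g[of i] h[of i] by (auto simp: coordinate_states_iff)
  have d_eq: "?d i = ?a i * norm (g i (v i) - h i (v i))" for i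
    by (simp add: norm_mult flip: right_diff_distrib)
  have d_le: "?d i \<le> 2 * (?a i * norm (v i))" for i
  proof -
    have "norm (g i (v i) - h i (v i)) \<le> 2 * norm (v i)"
      using norm_triangle_ineq4[of "g i (v i)" "h i (v i)"] gh(3,4)[of i "v i"] by simp
    then show ?thesis unfolding d_eq using mult_left_mono[of _ _ "?a i"] by fastforce
  qed
  have sm: "summable (\<lambda>i. ?a i * norm (v i))"
    by (rule Holder_summable[OF p]) (use v x_mem in \<open>auto simp: lp_space_def\<close>)
  have smd: "summable ?d"
    by (rule summable_comparison_test'[OF summable_mult[OF sm, of 2]]) (use d_le in auto)
  have sv: "summable (\<lambda>i. norm (v i) powr p)" using v by (simp add: lp_space_def)
  have tail_v: "(\<Sum>i. norm (v (i + n)) powr p) \<le> 1 powr p"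
  proof -
    have "(\<Sum>i. norm (v (i + n)) powr p) \<le> (\<Sum>i. norm (v i) powr p)"
      using suminf_split_initial_segment[OF sv, of n] by (simp add: sum_nonneg)
    also have "\<dots> \<le> 1 powr p"
      using N E.N_nonneg[OF v] p by (simp only: lp_norm_powr[OF v p, symmetric]) (intro powr_mono2, auto)
    finally show ?thesis .
  qed
  have smg: "summable (\<lambda>i. of_real (?a i) * g i (v i))" and smh: "summable (\<lambda>i. of_real (?a i) * h i (v i))"
    using glue_summable[of g, OF gh(3) v] glue_summable[of h, OF gh(4) v] by (auto dest: summable_norm_cancel)
  have "norm (glue g v - glue h v) = norm (\<Sum>i. of_real (?a i) * g i (v i) - of_real (?a i) * h i (v i))"
    using v suminf_diff[OF smg smh] by (simp add: glue_def)
  also have "\<dots> \<le> (\<Sum>i. ?d i)" by (rule summable_norm[OF smd])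
  also have "\<dots> = (\<Sum>i. ?d (i + n)) + (\<Sum>i<n. ?d i)"
    by (rule suminf_split_initial_segment[OF smd])
  also have "(\<Sum>i<n. ?d i) \<le> (\<Sum>i<n. \<delta>)"
  proof (rule sum_mono)
    fix i assume "i \<in> {..<n}"
    then have i: "norm_dist X.dual (dual_norm UNIV norm) (g i) (h i) \<le> \<delta>" using close by auto
    have v1: "norm (v i) \<le> 1" using norm_coord_le_lp_norm[OF v p, of i] N by simp
    have "norm (g i (v i) - h i (v i)) \<le> norm_dist X.dual (dual_norm UNIV norm) (g i) (h i) * norm (v i)"
      by (rule X.norm_diff_le_dist) (auto intro: gh)
    also have "\<dots> \<le> \<delta> * 1" using i v1 order_trans[OF X.dual.nonneg i] by (intro mult_mono) auto
    finally have "?a i * norm (g i (v i) - h i (v i)) \<le> 1 * \<delta>"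
      using norm_x_le[of i] p by (intro mult_mono) (auto intro: powr_le1)
    then show "?d i \<le> \<delta>" by (simp only: d_eq)
  qed
  also have "(\<Sum>i. ?d (i + n)) \<le> 2 * (A powr (p - 1) * 1)"
  proof -
    have "(\<Sum>i. ?d (i + n)) \<le> (\<Sum>i. 2 * (?a (i + n) * norm (v (i + n))))"
      by (intro suminf_le d_le summable_mult summable_ignore_initial_segment[OF smd]
        summable_ignore_initial_segment[OF sm, of n])
    also have "\<dots> = 2 * (\<Sum>i. ?a (i + n) * norm (v (i + n)))"
      by (rule suminf_mult) (rule summable_ignore_initial_segment[OF sm])
    also have "(\<Sum>i. ?a (i + n) * norm (v (i + n))) \<le> A powr (p - 1) * 1"
      by (rule Holder_series[OF p _ _ _ _ A(2,1) tail_v])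
        (auto intro: summable_ignore_initial_segment[OF summable_x] summable_ignore_initial_segment[OF sv])
    finally show ?thesis by simp
  qed
  finally show "norm (glue g v - glue h v) \<le> n * \<delta> + 2 * A powr (p - 1)" by simp
qed

text \<open>
  The tail of \<open>x\<close> is made small first, which leaves finitely many coordinates to be controlled: exactly
  what a neighbourhood in the product topology can do.
\<close>
lemma glue_continuous:
  "continuous_map
     (subtopology (product_topology (\<lambda>i. X.dual.mtopology) UNIV) (\<Pi>\<^sub>E i\<in>UNIV. coordinate_states i))
     E.dual.mtopology glue"
  unfolding E.dual.continuous_map_to_metric
proof (intro ballI allI impI)
  let ?K = "\<Pi>\<^sub>E i\<in>UNIV. coordinate_states i"
  let ?T = "product_topology (\<lambda>i::nat. X.dual.mtopology) UNIV"
  fix g and \<epsilon> :: real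
  assume "g \<in> topspace (subtopology ?T ?K)" and e: "0 < \<epsilon>"
  then have g: "g i \<in> coordinate_states i" for i by (auto simp: PiE_iff)
  have gX: "g i \<in> X.dual" for i using g[of i] by (simp add: coordinate_states_iff)
  define A where "A = (\<epsilon> / 8) powr (1 / (p - 1))"
  have A: "0 < A" "A powr (p - 1) = \<epsilon> / 8" using e p by (auto simp: A_def powr_powr)
  obtain n where "norm (\<Sum>i. norm (x (i + n)) powr p) < A powr p"
    using suminf_exist_split[OF _ summable_x, of "A powr p"] A by auto
  then have n: "(\<Sum>i. norm (x (i + n)) powr p) \<le> A powr p" by simp
  define \<delta> where "\<delta> = \<epsilon> / (4 * (real n + 1))"
  have d: "0 < \<delta>" "real n * \<delta> \<le> \<epsilon> / 4" using e by (auto simp: \<delta>_def field_simps)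
  define U where "U = (\<Pi>\<^sub>E i\<in>UNIV. if i < n then X.dual.mball (g i) \<delta> else X.dual)"
  show "\<exists>U. openin (subtopology ?T ?K) U \<and> g \<in> U \<and> (\<forall>h\<in>U. glue h \<in> E.dual.mball (glue g) \<epsilon>)"
  proof (intro exI[of _ "U \<inter> ?K"] conjI ballI)
    have "finite {i \<in> UNIV. (if i < n then X.dual.mball (g i) \<delta> else X.dual) \<noteq> X.dual}"
      by (rule finite_subset[of _ "{..<n}"]) auto
    then have "openin ?T U" unfolding U_def openin_PiE_gen by simp
    then show "openin (subtopology ?T ?K) (U \<inter> ?K)" by (auto simp: openin_subtopology)
    show "g \<in> U \<inter> ?K" using g gX d by (auto simp: U_def PiE_iff)
    fix h assume h: "h \<in> U \<inter> ?K"
    then have hK: "h i \<in> coordinate_states i" for i by (auto simp: PiE_iff)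
    have "norm_dist X.dual (dual_norm UNIV norm) (g i) (h i) \<le> \<delta>" if "i < n" for i
      using h that by (auto simp: U_def PiE_iff dest!: spec[of _ i])
    then have "norm_dist E.dual (dual_norm (lp_space p) (lp_norm p)) (glue g) (glue h)
        \<le> n * \<delta> + 2 * A powr (p - 1)"
      by (intro glue_dist_le g hK A n)
    also have "\<dots> < \<epsilon>" using d A e by simp
    finally show "glue h \<in> E.dual.mball (glue g) \<epsilon>"
      using glue_mem_state[OF g] glue_mem_state[OF hK] state_iff by auto
  qed
qed

text \<open>The map is Lipschitz, with the reciprocal of the weight as constant.\<close>
lemma coordinate_state_continuous:
  assumes "x i \<noteq> 0"
  shows "continuous_map E.dual.mtopology X.dual.mtopology (coordinate_state i)"
  unfolding E.dual.metric_continuous_map[OF X.dual.Metric_space_axioms]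
proof (intro conjI ballI allI impI)
  show "coordinate_state i ` E.dual \<subseteq> X.dual" using coordinate_state_mem_dual by auto
  let ?a = "norm (x i) powr (p - 1)"
  have a: "0 < ?a" using assms by simp
  fix f and \<epsilon> :: real assume f: "f \<in> E.dual" and e: "0 < \<epsilon>"
  let ?d = "norm_dist E.dual (dual_norm (lp_space p) (lp_norm p))"
  let ?d' = "norm_dist X.dual (dual_norm UNIV norm)"
  show "\<exists>\<delta>>0. \<forall>h. h \<in> E.dual \<and> ?d f h < \<delta> \<longrightarrow> ?d' (coordinate_state i f) (coordinate_state i h) < \<epsilon>"
  proof (intro exI[of _ "\<epsilon> * ?a"] conjI allI impI)
    fix h assume h: "h \<in> E.dual \<and> ?d f h < \<epsilon> * ?a"
    have "?d' (coordinate_state i f) (coordinate_state i h) \<le> ?d f h / ?a"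
    proof (rule X.dist_le)
      fix u :: 'a assume u: "norm u \<le> 1"
      have "norm (f (0(i := u)) - h (0(i := u))) \<le> ?d f h * norm u"
        using E.norm_diff_le_dist[OF f _ lp_space_single, of h i u] h by (simp add: lp_norm_single[OF p])
      also have "\<dots> \<le> ?d f h * 1" using u by (intro mult_left_mono) auto
      finally have "norm (f (0(i := u)) - h (0(i := u))) / ?a \<le> ?d f h / ?a"
        using a by (simp add: divide_right_mono)
      then show "norm (coordinate_state i f u - coordinate_state i h u) \<le> ?d f h / ?a"
        by (simp add: coordinate_state_def coordinate_functional_def norm_divide flip: diff_divide_distrib)
    qed (use f h coordinate_state_mem_dual in auto)
    also have "\<dots> < \<epsilon>" using h a by (simp add: field_simps)
    finally show "?d' (coordinate_state i f) (coordinate_state i h) < \<epsilon>" .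
  qed (use e a in simp)
qed

text \<open>
  One direction is Tychonoff's theorem and the image of a compact set under gluing. For the other
  one, an element of a single coordinate set must be completed to a family before it can be
  glued, and this needs every coordinate set to be nonempty.
\<close>
theorem compact_state_iff:
  assumes nonempty: "\<And>w :: 'a. norm w = 1 \<Longrightarrow> state_space sc UNIV norm w \<noteq> {}"
  shows "norm_compact_in_dual (seq_scale sc) (lp_space p) (lp_norm p) state \<longleftrightarrow>
    (\<forall>i. x i \<noteq> 0 \<longrightarrow> norm_compact_in_dual sc UNIV norm (state_space sc UNIV norm (x i /\<^sub>R norm (x i))))"
  unfolding norm_compact_in_dual_def E.norm_topology_dual X.norm_topology_dual
proof (intro iffI allI impI)
  fix i assume comp: "compactin E.dual.mtopology state" and xi: "x i \<noteq> 0"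
  have "coordinate_states j \<noteq> {}" for j
    using nonempty[of "x j /\<^sub>R norm (x j)"] by (auto simp: coordinate_states_def)
  then have "\<forall>j. \<exists>g. g \<in> coordinate_states j" by blast
  then have "\<exists>k. \<forall>j. k j \<in> coordinate_states j" by (rule choice)
  then obtain k where k: "k j \<in> coordinate_states j" for j by blast
  have "coordinate_states i \<subseteq> coordinate_state i ` state"
  proof
    fix g assume g: "g \<in> coordinate_states i"
    have mem: "(k(i := g)) j \<in> coordinate_states j" for j using k g by simp
    have "g = coordinate_state i (glue (k(i := g)))"
      using coordinate_state_glue[OF xi mem] by (simp only: fun_upd_same)
    then show "g \<in> coordinate_state i ` state" using glue_mem_state[OF mem] by blast
  qed
  then have "coordinate_state i ` state = coordinate_states i" using coordinate_state_mem by blast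
  then have "compactin X.dual.mtopology (coordinate_states i)"
    using image_compactin[OF comp coordinate_state_continuous[OF xi]] by simp
  then show "compactin X.dual.mtopology (state_space sc UNIV norm (x i /\<^sub>R norm (x i)))"
    using xi by (simp add: coordinate_states_def)
next
  assume comp: "\<forall>i. x i \<noteq> 0 \<longrightarrow> compactin X.dual.mtopology (state_space sc UNIV norm (x i /\<^sub>R norm (x i)))"
  let ?K = "\<Pi>\<^sub>E i\<in>UNIV. coordinate_states i"
  let ?T = "product_topology (\<lambda>i::nat. X.dual.mtopology) UNIV"
  have zero: "(0 :: 'a \<Rightarrow> 'k) \<in> X.dual" by (auto simp: dual_space_def intro: exI[of _ 0])
  have "compactin X.dual.mtopology (coordinate_states i)" for i
    using comp zero by (auto simp: coordinate_states_def intro: finite_imp_compactin)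
  then have "compactin ?T ?K" by (simp add: compactin_PiE)
  then have "compactin (subtopology ?T ?K) ?K" by (simp add: compactin_subtopology)
  then have "compactin E.dual.mtopology (glue ` ?K)" by (rule image_compactin[OF _ glue_continuous])
  then show "compactin E.dual.mtopology state" by (simp only: state_eq_glue_image)
qed

end

theorem corollary2p10:
  fixes p :: real
    and x :: "nat \<Rightarrow> 'a::banach"
    and sc :: "complex \<Rightarrow> 'b::banach \<Rightarrow> 'b" and z :: "nat \<Rightarrow> 'b"
  assumes "1 < p"
  shows
    "(x \<in> unit_sphere (lp_space p) (lp_norm p) \<longrightarrow>
        (norm_compact_in_dual (seq_scale scaleR) (lp_space p) (lp_norm p)
           (state_space (seq_scale scaleR) (lp_space p) (lp_norm p) x)
         \<longleftrightarrow>
         (\<forall>i. x i \<noteq> 0 \<longrightarrow>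
            norm_compact_in_dual scaleR UNIV norm
              (state_space scaleR UNIV norm (x i /\<^sub>R norm (x i))))))
     \<and>
     (normed_scaling sc \<and> z \<in> unit_sphere (lp_space p) (lp_norm p) \<longrightarrow>
        (norm_compact_in_dual (seq_scale sc) (lp_space p) (lp_norm p)
           (state_space (seq_scale sc) (lp_space p) (lp_norm p) z)
         \<longleftrightarrow>
         (\<forall>i. z i \<noteq> 0 \<longrightarrow>
            norm_compact_in_dual sc UNIV norm
              (state_space sc UNIV norm (z i /\<^sub>R norm (z i))))))"
proof (intro conjI impI)
  assume x: "x \<in> unit_sphere (lp_space p) (lp_norm p)"
  interpret normed_scaling "scaleR :: real \<Rightarrow> 'a \<Rightarrow> 'a" by (simp add: normed_scaling_real)
  interpret lp_sphere_point "scaleR :: real \<Rightarrow> 'a \<Rightarrow> 'a" p x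
    using x assms by unfold_locales (auto simp: unit_sphere_def)
  show "norm_compact_in_dual (seq_scale scaleR) (lp_space p) (lp_norm p)
      (state_space (seq_scale scaleR) (lp_space p) (lp_norm p) x) \<longleftrightarrow>
    (\<forall>i. x i \<noteq> 0 \<longrightarrow> norm_compact_in_dual scaleR UNIV norm
      (state_space scaleR UNIV norm (x i /\<^sub>R norm (x i))))"
    by (rule compact_state_iff) (rule state_space_real_nonempty)
next
  assume z: "normed_scaling sc \<and> z \<in> unit_sphere (lp_space p) (lp_norm p)"
  then interpret normed_scaling sc by simp
  interpret lp_sphere_point sc p z
    using z assms by unfold_locales (auto simp: unit_sphere_def)
  show "norm_compact_in_dual (seq_scale sc) (lp_space p) (lp_norm p)
      (state_space (seq_scale sc) (lp_space p) (lp_norm p) z) \<longleftrightarrow>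
    (\<forall>i. z i \<noteq> 0 \<longrightarrow> norm_compact_in_dual sc UNIV norm
      (state_space sc UNIV norm (z i /\<^sub>R norm (z i))))"
    using compact_state_iff state_space_complex_nonempty z by blast
qed

end
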